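(* Let $\Omega\subseteq\mathbb{H}$ be a speared domain, let $f:\Omega\to\mathbb{H}$ be a slice regular function and let $\{f^J:\Omega^J\to\mathbb{H}\}_{J\in\mathbb{S}}$ be the slice regular family associated to $f$. Fix $J_0\in\mathbb{S}$. There exists a speared open set $\Lambda\subseteq\mathbb{H}$ with \[\mathrm{core}(\Omega)\cup\Omega_{J_0}^{\geqslant}\subseteq\Lambda\subseteq\Omega\cap\Omega^{J_0}\] such that $f$ coincides with $f^{J_0}$ in $\Lambda$. In particular, for each $x_0\in\Omega_{J_0}^{\geqslant}$, $f$ coincides with $f^{J_0}$ in a speared domain including $x_0$: namely, the connected component of $\Lambda$ including $x_0$.
   Context: Basic notation. $\mathbb{H}$ is the algebra of quaternions (Euclidean topology), $\mathbb{S}=\{w\in\mathbb{H}: w^2=-1\}$. For $I\in\mathbb{S}$: $\mathbb{C}_I=\mathbb{R}+\mathbb{R}I$, $\mathbb{C}_I^{\geqslant}=\{\alpha+\beta I:\alpha,\beta\in\mathbb{R},\beta\ge0\}$. For $T\subseteq\mathbb{H}$: $T_I=T\cap\mathbb{C}_I$, $T_I^{\geqslant}=T\cap\mathbb{C}_I^{\geqslant}$. A domain is a nonempty connected open subset of $\mathbb{H}$. A function $f:\Omega\to\mathbb{H}$ on a domain is slice regular if for every $I\in\mathbb{S}$ the restriction $f_{|\Omega_I}$ is $C^1$ and $\left(\frac{\partial}{\partial\alpha}+I\frac{\partial}{\partial\beta}\right)f(\alpha+\beta I)=0$ on $\Omega_I$. Speared sets. An open $U\subseteq\mathbb{H}$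 is speared if, for all $I\in\mathbb{S}$, each connected component of $U_I^{\geqslant}$ includes a real point. A speared domain is a domain that is a speared open set. A set $T\subseteq\mathbb{H}$ is symmetric if $\alpha+\beta I\in T$ ($\alpha,\beta\in\mathbb{R}$, $I\in\mathbb{S}$) implies $\alpha+\beta\mathbb{S}\subseteq T$. For $U$ open, $\mathrm{core}(U)$ is the largest symmetric speared open subset of $U$. Stem functions. $\mathbb{H}_{\mathbb{C}}=\mathbb{H}\otimes_{\mathbb{R}}\mathbb{C}=\{x+\imath y: x,y\in\mathbb{H}\}$, with $\imath$ central and $\imath^2=-1$; $\overline{x+\imath y}=x-\imath y$; $\mathbb{R}_{\mathbb{C}}=\mathbb{R}+\imath\mathbb{R}\subset\mathbb{H}_{\mathbb{C}}$. For $E\subseteq\mathbb{R}_{\mathbb{C}}$, $\overline E$ is its image under conjugation, and its circularization is $\Omega_E=\{\alpha+\beta I:\alpha+\imath\beta\in E, I\in\mathbb{S}\}\subseteq\mathbb{H}$. For $J\in\mathbb{S}$, $\phi_J:\mathbb{R}_{\mathbb{C}}\to\mathbb{C}_J$ is the bijection $\alpha+\imath\beta\mapsto\alpha+\beta J$. If $D=\overline D\subseteq\mathbb{R}_{\mathbb{C}}$ is open, a stem function is $F=F_1+\imath F_2:D\to\mathbb{H}_{\mathbb{C}}$ ($F_1,F_2$ being $\mathbb{H}$-valued) with $F(\bar z)=\overline{F(z)}$; it is holomorphic if it is so with respect to multiplication by $\imath$; it induces the slice function $\mathcal{I}(F):\Omega_D\to\mathbb{H}$, $\mathcal{I}(F)(\alpha+\beta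 J)=F_1(\alpha+\imath\beta)+J F_2(\alpha+\imath\beta)$. Families associated to $f$. Let $f$ be slice regular on a speared domain $\Omega$. For distinct $J,K\in\mathbb{S}$ set $E^{J,K}=\phi_J^{-1}(\Omega_J^{\geqslant})\cap\phi_K^{-1}(\Omega_K^{\geqslant})$, $D^{J,K}=E^{J,K}\cup\overline{E^{J,K}}$, and let $F^{J,K}:D^{J,K}\to\mathbb{H}_{\mathbb{C}}$ be the holomorphic stem function with \[F^{J,K}(\alpha+\imath\beta)=(J-K)^{-1}[Jf(\alpha+\beta J)-Kf(\alpha+\beta K)]+\imath(J-K)^{-1}[f(\alpha+\beta J)-f(\alpha+\beta K)]\] for $\alpha+\imath\beta\in E^{J,K}$, and $F^{J,K}(\bar z)=\overline{F^{J,K}(z)}$. For $J\in\mathbb{S}$ set $D^J=\phi_J^{-1}(\Omega_J^{\geqslant})\cup\overline{\phi_J^{-1}(\Omega_J^{\geqslant})}$. For each $z\in D^J$ the value $F^{J,K}(z)$ is defined and independent of $K$ for all $K\in\mathbb{S}\setminus\{J\}$ sufficiently close to $J$; $F^J(z)$ denotes this common value. This defines a holomorphic stem function $F^J:D^J\to\mathbb{H}_{\mathbb{C}}$. The slice regular family associated to $f$ consists of the functions $f^J=\mathcal{I}(F^J):\Omega^J\to\mathbb{H}$, where $\Omega^J=\Omega_{D^J}$. *)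

theory Defs
  imports "HOL-Analysis.Analysis"
begin

section \<open>The algebra of quaternions with its Euclidean topology\<close>

datatype quat = Quat (q0: real) (q1: real) (q2: real) (q3: real)

lemma quat_eq_iff: "x = y \<longleftrightarrow> q0 x = q0 y \<and> q1 x = q1 y \<and> q2 x = q2 y \<and> q3 x = q3 y"
  by (cases x; cases y) auto

instantiation quat :: ring_1
begin

definition zero_quat_def: "0 = Quat 0 0 0 0"
definition one_quat_def: "1 = Quat 1 0 0 0"
definition plus_quat_def: "x + y = Quat (q0 x + q0 y) (q1 x + q1 y) (q2 x + q2 y) (q3 x + q3 y)"
definition uminus_quat_def: "- x = Quat (- q0 x) (- q1 x) (- q2 x) (- q3 x)"
definition minus_quat_def: "x - y = Quat (q0 x - q0 y) (q1 x - q1 y) (q2 x - q2 y) (q3 x - q3 y)"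
definition times_quat_def: "x * y = Quat
  (q0 x * q0 y - q1 x * q1 y - q2 x * q2 y - q3 x * q3 y)
  (q0 x * q1 y + q1 x * q0 y + q2 x * q3 y - q3 x * q2 y)
  (q0 x * q2 y - q1 x * q3 y + q2 x * q0 y + q3 x * q1 y)
  (q0 x * q3 y + q1 x * q2 y - q2 x * q1 y + q3 x * q0 y)"

instance
  by standard
    (simp_all add: quat_eq_iff zero_quat_def one_quat_def plus_quat_def uminus_quat_def
      minus_quat_def times_quat_def algebra_simps)

end

lemma quat_sel_ring [simp]:
  "q0 0 = 0" "q1 0 = 0" "q2 0 = 0" "q3 0 = 0"
  "q0 1 = 1" "q1 1 = 0" "q2 1 = 0" "q3 1 = 0"
  "q0 (x + y) = q0 x + q0 y" "q1 (x + y) = q1 x + q1 y"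
  "q2 (x + y) = q2 x + q2 y" "q3 (x + y) = q3 x + q3 y"
  "q0 (- x) = - q0 x" "q1 (- x) = - q1 x" "q2 (- x) = - q2 x" "q3 (- x) = - q3 x"
  "q0 (x - y) = q0 x - q0 y" "q1 (x - y) = q1 x - q1 y"
  "q2 (x - y) = q2 x - q2 y" "q3 (x - y) = q3 x - q3 y"
  by (simp_all add: zero_quat_def one_quat_def plus_quat_def uminus_quat_def minus_quat_def)

lemma quat_sel_times [simp]:
  "q0 (x * y) = q0 x * q0 y - q1 x * q1 y - q2 x * q2 y - q3 x * q3 y"
  "q1 (x * y) = q0 x * q1 y + q1 x * q0 y + q2 x * q3 y - q3 x * q2 y"
  "q2 (x * y) = q0 x * q2 y - q1 x * q3 y + q2 x * q0 y + q3 x * q1 y"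
  "q3 (x * y) = q0 x * q3 y + q1 x * q2 y - q2 x * q1 y + q3 x * q0 y"
  by (simp_all add: times_quat_def)

instantiation quat :: real_algebra_1
begin

definition scaleR_quat_def: "r *\<^sub>R x = Quat (r * q0 x) (r * q1 x) (r * q2 x) (r * q3 x)"

instance
  by standard (simp_all add: quat_eq_iff scaleR_quat_def algebra_simps)

end

lemma quat_sel_scaleR [simp]:
  "q0 (r *\<^sub>R x) = r * q0 x" "q1 (r *\<^sub>R x) = r * q1 x"
  "q2 (r *\<^sub>R x) = r * q2 x" "q3 (r *\<^sub>R x) = r * q3 x"
  by (simp_all add: scaleR_quat_def)

lemma quat_sel_of_real [simp]:
  "q0 (of_real r) = r" "q1 (of_real r) = 0" "q2 (of_real r) = 0" "q3 (of_real r) = 0"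
  by (simp_all add: of_real_def)

instantiation quat :: real_inner
begin

definition inner_quat_def: "inner x y = q0 x * q0 y + q1 x * q1 y + q2 x * q2 y + q3 x * q3 y"
definition norm_quat_def: "norm (x::quat) = sqrt (inner x x)"
definition sgn_quat_def: "sgn (x::quat) = x /\<^sub>R norm x"
definition dist_quat_def: "dist (x::quat) y = norm (x - y)"
definition uniformity_quat_def [code del]:
  "(uniformity :: (quat \<times> quat) filter) = (INF e\<in>{0 <..}. principal {(x, y). dist x y < e})"
definition open_quat_def [code del]:
  "open (U :: quat set) \<longleftrightarrow> (\<forall>x\<in>U. eventually (\<lambda>(x', y). x' = x \<longrightarrow> y \<in> U) uniformity)"

instance
proof
  fix x y z :: quat and r :: real
  show "inner x y = inner y x"
    by (simp add: inner_quat_def mult.commute)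
  show "inner (x + y) z = inner x z + inner y z"
    by (simp add: inner_quat_def algebra_simps)
  show "inner (scaleR r x) y = r * inner x y"
    by (simp add: inner_quat_def algebra_simps)
  show "0 \<le> inner x x"
    by (simp add: inner_quat_def)
  show "inner x x = 0 \<longleftrightarrow> x = 0"
    by (simp add: inner_quat_def add_nonneg_eq_0_iff quat_eq_iff)
qed (rule norm_quat_def sgn_quat_def dist_quat_def uniformity_quat_def open_quat_def)+

end

declare uniformity_Abort[where 'a = quat, code]

lemma norm_quat_sq: "(norm (x::quat))\<^sup>2 = (q0 x)\<^sup>2 + (q1 x)\<^sup>2 + (q2 x)\<^sup>2 + (q3 x)\<^sup>2"
  unfolding power2_norm_eq_inner inner_quat_def by (simp add: power2_eq_square)

instantiation quat :: real_normed_div_algebra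
begin

definition inverse_quat_def:
  "inverse x = Quat (q0 x) (- q1 x) (- q2 x) (- q3 x) /\<^sub>R ((q0 x)\<^sup>2 + (q1 x)\<^sup>2 + (q2 x)\<^sup>2 + (q3 x)\<^sup>2)"
definition divide_quat_def: "x div (y::quat) = x * inverse y"

instance
proof
  fix x y :: quat
  define n where "n = (q0 x)\<^sup>2 + (q1 x)\<^sup>2 + (q2 x)\<^sup>2 + (q3 x)\<^sup>2"
  define c where "c = Quat (q0 x) (- q1 x) (- q2 x) (- q3 x)"
  have "c * x = n *\<^sub>R 1" "x * c = n *\<^sub>R 1"
    by (simp_all add: quat_eq_iff c_def n_def power2_eq_square)
  moreover have "inverse x = c /\<^sub>R n"
    by (simp add: inverse_quat_def c_def n_def)
  moreover have "n \<noteq> 0" if "x \<noteq> 0"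
    using that unfolding n_def norm_quat_sq[symmetric] by simp
  ultimately show "x \<noteq> 0 \<Longrightarrow> inverse x * x = 1" "x \<noteq> 0 \<Longrightarrow> x * inverse x = 1"
    by simp_all
  show "x div y = x * inverse y"
    by (rule divide_quat_def)
  show "inverse (0::quat) = 0"
    by (simp add: inverse_quat_def)
  have "(norm (x * y))\<^sup>2 = (norm x * norm y)\<^sup>2"
    unfolding power_mult_distrib norm_quat_sq quat_sel_times by algebra
  then show "norm (x * y) = norm x * norm y"
    by simp
qed

end

instantiation quat :: euclidean_space
begin

definition Basis_quat_def: "Basis = {Quat 1 0 0 0, Quat 0 1 0 0, Quat 0 0 1 0, Quat 0 0 0 1}"

instance
proof
  fix x u v :: quat
  show "u \<in> Basis \<Longrightarrow> v \<in> Basis \<Longrightarrow> inner u v = (if u = v then 1 else 0)"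
    unfolding Basis_quat_def by (elim insertE emptyE) (simp_all add: inner_quat_def)
  show "(\<forall>u\<in>Basis. inner x u = 0) \<longleftrightarrow> x = 0"
    unfolding Basis_quat_def quat_eq_iff[of x 0] by (simp add: inner_quat_def)
qed (simp_all add: Basis_quat_def)

end

section \<open>Slices\<close>

definition imag_units :: "quat set" ("\<S>")
  where "\<S> = {w. w\<^sup>2 = -1}"

text \<open>The algebra \<open>\<real> + \<iota>\<real>\<close> is identified with \<^typ>\<open>complex\<close>, its conjugation
  being \<^const>\<open>cnj\<close>.\<close>

definition phi :: "quat \<Rightarrow> complex \<Rightarrow> quat"
  where "phi J z = of_real (Re z) + of_real (Im z) * J"

definition half_plane :: "quat \<Rightarrow> quat set"
  where "half_plane I = {phi I z | z. Im z \<ge> 0}"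

definition half_slice :: "quat set \<Rightarrow> quat \<Rightarrow> quat set"
  where "half_slice T I = T \<inter> half_plane I"

definition is_domain :: "quat set \<Rightarrow> bool"
  where "is_domain U \<longleftrightarrow> U \<noteq> {} \<and> connected U \<and> open U"

text \<open>For \<open>I \<in> \<S>\<close>, the set \<^term>\<open>phi I -` \<Omega>\<close> is the slice \<open>\<Omega> \<inter> \<complex>\<^sub>I\<close> in the coordinate
  \<open>z = \<alpha> + \<i>\<beta>\<close>; there, \<^term>\<open>g' z\<close> is the real differential of \<open>(\<alpha>, \<beta>) \<mapsto> f (\<alpha> + \<beta>I)\<close>, and its values at
  \<^term>\<open>1::complex\<close> and \<^term>\<open>\<i>\<close> are the partial derivatives with respect to \<open>\<alpha>\<close> and \<open>\<beta>\<close>.\<close>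

definition slice_regular_on :: "quat set \<Rightarrow> (quat \<Rightarrow> quat) \<Rightarrow> bool"
  where "slice_regular_on \<Omega> f \<longleftrightarrow>
    (\<forall>I\<in>\<S>. \<exists>g' :: complex \<Rightarrow> (complex \<Rightarrow>\<^sub>L quat).
      continuous_on (phi I -` \<Omega>) g' \<and>
      (\<forall>z \<in> phi I -` \<Omega>.
        ((\<lambda>z. f (phi I z)) has_derivative blinfun_apply (g' z)) (at z) \<and>
        blinfun_apply (g' z) 1 + I * blinfun_apply (g' z) \<i> = 0))"

section \<open>Speared sets and the core\<close>

definition speared :: "quat set \<Rightarrow> bool"
  where "speared U \<longleftrightarrow>
    open U \<and> (\<forall>I\<in>\<S>. \<forall>C \<in> components (half_slice U I). \<exists>r::real. of_real r \<in> C)"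

definition speared_domain :: "quat set \<Rightarrow> bool"
  where "speared_domain U \<longleftrightarrow> is_domain U \<and> speared U"

definition symmetric_set :: "quat set \<Rightarrow> bool"
  where "symmetric_set T \<longleftrightarrow>
    (\<forall>z. \<forall>I\<in>\<S>. phi I z \<in> T \<longrightarrow> (\<forall>J\<in>\<S>. phi J z \<in> T))"

definition core :: "quat set \<Rightarrow> quat set"
  where "core U = (GREATEST T. T \<subseteq> U \<and> symmetric_set T \<and> speared T)"

lemma core_props:
  shows "core U \<subseteq> U \<and> symmetric_set (core U) \<and> speared (core U)"
    and "T \<subseteq> U \<Longrightarrow> symmetric_set T \<Longrightarrow> speared T \<Longrightarrow> T \<subseteq> core U"
proof -
  define P where "P T \<longleftrightarrow> T \<subseteq> U \<and> symmetric_set T \<and> speared T" for T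
  define W where "W = \<Union>{T. P T}"
  have "speared W"
    unfolding speared_def
  proof (intro conjI ballI)
    show "open W" by (auto simp: W_def P_def speared_def)
    fix I C assume I: "I \<in> \<S>" and "C \<in> components (half_slice W I)"
    then obtain x where x: "x \<in> half_slice W I"
      and C: "C = connected_component_set (half_slice W I) x"
      by (auto simp: components_def)
    then obtain A where A: "P A" "x \<in> half_slice A I"
      by (auto simp: W_def half_slice_def)
    then have "connected_component_set (half_slice A I) x \<in> components (half_slice A I)"
      by (intro componentsI)
    moreover have "speared A"
      using A by (simp add: P_def)
    ultimately obtain r :: real where "of_real r \<in> connected_component_set (half_slice A I) x"
      using I unfolding speared_def by blast
    moreover have "half_slice A I \<subseteq> half_slice W I"
      using A by (auto simp: W_def half_slice_def)
    ultimately show "\<exists>r::real. of_real r \<in> C"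
      using C connected_component_mono by blast
  qed
  moreover have "symmetric_set W"
    unfolding W_def P_def symmetric_set_def by blast
  ultimately have W: "P W" "\<And>T. P T \<Longrightarrow> T \<subseteq> W"
    by (auto simp: W_def P_def)
  then have "core U = W"
    unfolding core_def P_def by (intro Greatest_equality) auto
  with W show "core U \<subseteq> U \<and> symmetric_set (core U) \<and> speared (core U)"
    and "T \<subseteq> U \<Longrightarrow> symmetric_set T \<Longrightarrow> speared T \<Longrightarrow> T \<subseteq> core U"
    by (simp_all add: P_def)
qed

section \<open>Stem functions and the slice functions they induce\<close>

text \<open>An element \<open>x + \<iota>y\<close> of \<open>\<H> \<otimes> \<complex>\<close> is represented by the pair \<open>(x, y)\<close>.\<close>

type_synonym hc = "quat \<times> quat"

definition hc_cnj :: "hc \<Rightarrow> hc"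
  where "hc_cnj w = (fst w, - snd w)"

definition circularization :: "complex set \<Rightarrow> quat set"
  where "circularization E = {phi I z | I z. I \<in> \<S> \<and> z \<in> E}"

text \<open>If \<open>D\<close> is closed under conjugation and \<open>F (cnj z) = hc_cnj (F z)\<close> on \<open>D\<close>, the value does not
  depend on the representation \<open>x = \<alpha> + \<beta>J\<close>. It is meaningful for \<^term>\<open>x \<in> circularization D\<close>.\<close>

definition induced_slice_fun :: "complex set \<Rightarrow> (complex \<Rightarrow> hc) \<Rightarrow> quat \<Rightarrow> quat"
  where "induced_slice_fun D F x =
    (THE y. \<exists>z\<in>D. \<exists>J\<in>\<S>. x = phi J z \<and> y = fst (F z) + J * snd (F z))"

section \<open>The slice regular family associated to a function\<close>

text \<open>\<open>E_pair \<Omega> J K\<close>, \<open>D_pair \<Omega> J K\<close> and \<open>F_pair f J K\<close> are \<open>E\<^sup>J\<^sup>,\<^sup>K\<close>, \<open>D\<^sup>J\<^sup>,\<^sup>K\<close> and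
  \<open>F\<^sup>J\<^sup>,\<^sup>K\<close>, for distinct \<open>J, K \<in> \<S>\<close>; \<open>F_pair f J K\<close> is a total function, meaningful only on
  \<open>D_pair \<Omega> J K\<close>. \<open>E_pair \<Omega> J K\<close> lies in the closed upper half-plane.\<close>

definition E_pair :: "quat set \<Rightarrow> quat \<Rightarrow> quat \<Rightarrow> complex set"
  where "E_pair \<Omega> J K = phi J -` half_slice \<Omega> J \<inter> phi K -` half_slice \<Omega> K"

definition D_pair :: "quat set \<Rightarrow> quat \<Rightarrow> quat \<Rightarrow> complex set"
  where "D_pair \<Omega> J K = E_pair \<Omega> J K \<union> cnj ` E_pair \<Omega> J K"

definition F_pair_upper :: "(quat \<Rightarrow> quat) \<Rightarrow> quat \<Rightarrow> quat \<Rightarrow> complex \<Rightarrow> hc"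
  where "F_pair_upper f J K z =
    (inverse (J - K) * (J * f (phi J z) - K * f (phi K z)),
     inverse (J - K) * (f (phi J z) - f (phi K z)))"

definition F_pair :: "(quat \<Rightarrow> quat) \<Rightarrow> quat \<Rightarrow> quat \<Rightarrow> complex \<Rightarrow> hc"
  where "F_pair f J K z =
    (if Im z \<ge> 0 then F_pair_upper f J K z else hc_cnj (F_pair_upper f J K (cnj z)))"

lemma F_pair_cnj: "F_pair f J K (cnj z) = hc_cnj (F_pair f J K z)"
proof (cases "Im z = 0")
  case True
  then have "cnj z = z" "phi J z = phi K z"
    by (auto simp: complex_eq_iff phi_def)
  with True show ?thesis by (simp add: F_pair_def F_pair_upper_def hc_cnj_def)
qed (auto simp: F_pair_def hc_cnj_def)

text \<open>\<open>D_unit \<Omega> J\<close> and \<open>F_unit \<Omega> f J\<close> are \<open>D\<^sup>J\<close> and \<open>F\<^sup>J\<close>. The filter \<^term>\<open>at J within \<S>\<close>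
  expresses ``for all \<open>K \<in> \<S> - {J}\<close> sufficiently close to \<open>J\<close>''.\<close>

definition D_unit :: "quat set \<Rightarrow> quat \<Rightarrow> complex set"
  where "D_unit \<Omega> J = phi J -` half_slice \<Omega> J \<union> cnj ` (phi J -` half_slice \<Omega> J)"

definition F_unit :: "quat set \<Rightarrow> (quat \<Rightarrow> quat) \<Rightarrow> quat \<Rightarrow> complex \<Rightarrow> hc"
  where "F_unit \<Omega> f J z =
    (THE w. eventually (\<lambda>K. z \<in> D_pair \<Omega> J K \<and> F_pair f J K z = w) (at J within \<S>))"

text \<open>\<open>family_dom \<Omega> J\<close> and \<open>family_fun \<Omega> f J\<close> are \<open>\<Omega>\<^sup>J\<close> and \<open>f\<^sup>J\<close>.\<close>

definition family_dom :: "quat set \<Rightarrow> quat \<Rightarrow> quat set"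
  where "family_dom \<Omega> J = circularization (D_unit \<Omega> J)"

definition family_fun :: "quat set \<Rightarrow> (quat \<Rightarrow> quat) \<Rightarrow> quat \<Rightarrow> quat \<Rightarrow> quat"
  where "family_fun \<Omega> f J = induced_slice_fun (D_unit \<Omega> J) (F_unit \<Omega> f J)"

end

(*
  Let V be the open set of all z for which phi J z, phi K z and phi L z lie in \<Omega>. The
  difference between f (phi L z) and the value predicted from f (phi J z) and f (phi K z) by the
  representation formula is holomorphic on V with respect to left multiplication by L, and it
  vanishes on the real axis, hence on each component of V that meets the real axis. Since \<Omega> is
  speared, points are joined to the axis by compact connected sets inside half slices, and such
  sets remain in \<Omega> when J is replaced by a nearby unit K. So one takes for \<Lambda> all phi L z
  such that some compact connected subset of the upper half plane contains z and a real point and is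
  mapped into \<Omega> by both phi J\<^sub>0 and phi L; stability under small perturbations makes
  \<Lambda> open.
*)

theory Submission
  imports Defs "HOL-Complex_Analysis.Conformal_Mappings"
begin

section \<open>Imaginary units and the coordinates on slices\<close>

text \<open>The last three components of \<open>w * w\<close> are \<open>2 * q0 w\<close> times
  those of \<open>w\<close>, so a nonzero \<open>q0 w\<close> would make \<open>w\<close> a real
  number with square -1.\<close>

lemma imag_units_iff: "w \<in> \<S> \<longleftrightarrow> q0 w = 0 \<and> norm w = 1"
proof -
  have sq: "w\<^sup>2 = -1 \<longleftrightarrow> q0 w = 0 \<and> (q1 w)\<^sup>2 + (q2 w)\<^sup>2 + (q3 w)\<^sup>2 = 1"
  proof
    assume w: "w\<^sup>2 = -1"
    then have eqs: "q0 w * q0 w - q1 w * q1 w - q2 w * q2 w - q3 w * q3 w = -1"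
      "q0 w * q1 w = 0" "q0 w * q2 w = 0" "q0 w * q3 w = 0"
      by (simp_all add: quat_eq_iff power2_eq_square)
    have "q0 w = 0"
    proof (rule ccontr)
      assume "q0 w \<noteq> 0"
      with eqs have "q0 w * q0 w = -1" by simp
      then show False using zero_le_square[of "q0 w"] by linarith
    qed
    with eqs show "q0 w = 0 \<and> (q1 w)\<^sup>2 + (q2 w)\<^sup>2 + (q3 w)\<^sup>2 = 1"
      by (simp add: power2_eq_square)
  qed (simp add: quat_eq_iff power2_eq_square)
  have "norm w = 1 \<longleftrightarrow> (norm w)\<^sup>2 = 1"
    by (simp add: power2_eq_1_iff)
       (metis norm_ge_zero zero_neq_one neg_0_le_iff_le not_one_le_zero)
  then have "norm w = 1 \<longleftrightarrow> (q0 w)\<^sup>2 + (q1 w)\<^sup>2 + (q2 w)\<^sup>2 + (q3 w)\<^sup>2 = 1"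
    by (simp add: norm_quat_sq)
  with sq show ?thesis
    by (auto simp: imag_units_def)
qed

lemma imag_units_square: "J \<in> \<S> \<Longrightarrow> J * J = -1"
  by (simp add: imag_units_def power2_eq_square)

lemma imag_units_left_mult: "J \<in> \<S> \<Longrightarrow> J * (J * x) = - x"
  by (metis imag_units_square mult.assoc mult_minus1)

lemma uminus_imag_units: "J \<in> \<S> \<Longrightarrow> - J \<in> \<S>"
  by (simp add: imag_units_def)

text \<open>The unit sphere of a three-dimensional space is connected, and \<open>\<S>\<close> is
  its image under an isometric linear embedding.\<close>

lemma connected_imag_units: "connected \<S>"
proof -
  define e :: "real ^ 3 \<Rightarrow> quat" where "e = (\<lambda>v. Quat 0 (v$1) (v$2) (v$3))"
  have "linear e"
    by (rule linearI) (simp_all add: e_def quat_eq_iff)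
  then have "continuous_on (sphere 0 1) e"
    by (simp add: linear_continuous_on linear_linear)
  moreover have "connected (sphere (0 :: real ^ 3) 1)"
    by (rule connected_sphere) simp
  ultimately have "connected (e ` sphere 0 1)"
    by (rule connected_continuous_image)
  moreover have "e ` sphere 0 1 = \<S>"
  proof -
    have n: "norm (e v) = norm v" for v
      by (simp add: norm_eq_sqrt_inner inner_quat_def inner_vec_def sum_3 e_def)
    have "w \<in> e ` sphere 0 1" if "w \<in> \<S>" for w
    proof
      show w: "w = e (vector [q1 w, q2 w, q3 w])"
        using that by (simp add: e_def quat_eq_iff imag_units_iff)
      show "vector [q1 w, q2 w, q3 w] \<in> sphere (0 :: real ^ 3) 1"
        using that n w by (metis imag_units_iff mem_sphere_0)
    qed
    moreover have "e v \<in> \<S>" if "v \<in> sphere 0 1" for v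
      using that by (simp add: imag_units_iff n) (simp add: e_def)
    ultimately show ?thesis by auto
  qed
  ultimately show ?thesis by simp
qed

text \<open>A connected set with the two points \<open>J\<close> and \<open>-J\<close> has no
  isolated points. Hence a property of all units near \<open>J\<close> is never vacuous, which makes
  the value selected in \<open>F_unit\<close> unique.\<close>

lemma at_within_imag_units_nontrivial:
  assumes "J \<in> \<S>"
  shows "at J within \<S> \<noteq> bot"
proof -
  have "-J \<noteq> J"
    using assms by (auto simp: imag_units_iff quat_eq_iff norm_eq_sqrt_inner inner_quat_def)
  then have "\<S> \<noteq> {x}" for x
    using assms uminus_imag_units[OF assms] by (metis singletonD)
  then show ?thesis
    using connected_imp_perfect[OF connected_imag_units assms]
    by (simp add: trivial_limit_within)
qed

lemma phi_of_real: "phi J (of_real r) = of_real r"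
  by (simp add: phi_def)

lemma phi_real: "Im z = 0 \<Longrightarrow> phi J z = of_real (Re z)"
  by (simp add: phi_def)

lemma phi_diff: "phi J (z - w) = phi J z - phi J w"
  by (simp add: phi_def algebra_simps)

lemma norm_phi:
  assumes "J \<in> \<S>"
  shows "norm (phi J z) = norm z"
proof -
  have q: "q0 J = 0" "(q1 J)\<^sup>2 + (q2 J)\<^sup>2 + (q3 J)\<^sup>2 = 1"
    using assms norm_quat_sq[of J] by (simp_all add: imag_units_iff)
  have "(norm (phi J z))\<^sup>2 = (Re z)\<^sup>2 + (Im z)\<^sup>2 * ((q1 J)\<^sup>2 + (q2 J)\<^sup>2 + (q3 J)\<^sup>2)"
    by (simp add: norm_quat_sq phi_def q(1) algebra_simps)
  then have "(norm (phi J z))\<^sup>2 = (norm z)\<^sup>2"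
    by (simp add: q cmod_power2)
  then show ?thesis by simp
qed

lemma dist_phi: "J \<in> \<S> \<Longrightarrow> dist (phi J z) (phi J w) = dist z w"
  by (simp add: dist_norm norm_phi flip: phi_diff)

lemma continuous_on_phi: "continuous_on A (phi J)"
  unfolding phi_def by (intro continuous_intros)

text \<open>Equality of the real components gives \<open>Re w = Re z\<close>; the norms of the
  imaginary parts then determine \<open>Im w\<close> up to sign. A real point leaves the units
  unrelated, and otherwise a change of sign affects unit and coordinate together.\<close>

lemma phi_eq_phi_cases:
  assumes "J \<in> \<S>" "K \<in> \<S>" "phi J z = phi K w"
  obtains "w = z" "Im z = 0" | "w = z" "K = J" | "w = cnj z" "K = - J"
proof -
  have q: "q0 J = 0" "q0 K = 0" and n: "norm J = 1" "norm K = 1"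
    using assms by (auto simp: imag_units_iff)
  have "q0 (phi J z) = q0 (phi K w)"
    using assms by simp
  then have re: "Re w = Re z"
    by (simp add: phi_def q)
  with assms have im: "Im z *\<^sub>R J = Im w *\<^sub>R K"
    by (simp add: phi_def scaleR_conv_of_real)
  then have "\<bar>Im z\<bar> = \<bar>Im w\<bar>"
    using n by (metis norm_scaleR mult.right_neutral)
  then consider "Im z = 0" "Im w = 0" | "Im z \<noteq> 0" "Im w = Im z" | "Im z \<noteq> 0" "Im w = - Im z"
    by linarith
  then show thesis
    using im re that by cases (auto simp: complex_eq_iff, metis minus_equation_iff scaleR_left_imp_eq scaleR_minus_right)
qed

lemma phi_in_half_plane_iff:
  assumes "J \<in> \<S>"
  shows "phi J z \<in> half_plane J \<longleftrightarrow> Im z \<ge> 0"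
proof
  assume "phi J z \<in> half_plane J"
  then obtain w where "phi J z = phi J w" "Im w \<ge> 0"
    by (auto simp: half_plane_def)
  \<comment> \<open>\<open>phi J\<close> is isometric, hence injective, so
    \<open>w = z\<close>.\<close>
  then show "Im z \<ge> 0"
    using assms dist_phi[of J z w] by simp
qed (auto simp: half_plane_def)

lemma phi_in_half_slice_iff:
  "J \<in> \<S> \<Longrightarrow> phi J z \<in> half_slice U J \<longleftrightarrow> phi J z \<in> U \<and> Im z \<ge> 0"
  by (simp add: half_slice_def phi_in_half_plane_iff)

text \<open>Away from the real axis, \<open>x \<mapsto> (unit_part x, upper_coord x)\<close> is the continuous
  inverse of \<open>(J, z) \<mapsto> phi J z\<close> for \<open>Im z > 0\<close>.\<close>

definition imag_part :: "quat \<Rightarrow> quat"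
  where "imag_part x = x - of_real (q0 x)"

definition unit_part :: "quat \<Rightarrow> quat"
  where "unit_part x = imag_part x /\<^sub>R norm (imag_part x)"

definition upper_coord :: "quat \<Rightarrow> complex"
  where "upper_coord x = Complex (q0 x) (norm (imag_part x))"

lemma continuous_imag_part: "isCont imag_part x"
proof -
  have "linear (\<lambda>x. x - of_real (q0 x) :: quat)"
    by (rule linearI) (simp_all add: quat_eq_iff algebra_simps)
  then show ?thesis
    by (simp add: imag_part_def[abs_def] linear_linear linear_continuous_at)
qed

lemma continuous_q0: "isCont q0 x"
proof -
  have "linear q0"
    by (rule linearI) simp_all
  then show ?thesis
    by (simp add: linear_linear linear_continuous_at)
qed

lemma continuous_upper_coord: "isCont upper_coord x"
proof -
  have "upper_coord = (\<lambda>x. of_real (q0 x) + \<i> * of_real (norm (imag_part x)))"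
    by (auto simp: upper_coord_def complex_eq_iff)
  moreover have "isCont (\<lambda>x. of_real (q0 x) + \<i> * of_real (norm (imag_part x)) :: complex) x"
    by (intro continuous_intros continuous_q0 continuous_imag_part)
  ultimately show ?thesis by metis
qed

lemma unit_part_in_imag_units: "imag_part x \<noteq> 0 \<Longrightarrow> unit_part x \<in> \<S>"
  by (simp add: imag_units_iff unit_part_def) (simp add: imag_part_def)

lemma phi_unit_part: "imag_part x \<noteq> 0 \<Longrightarrow> phi (unit_part x) (upper_coord x) = x"
  by (simp add: phi_def unit_part_def upper_coord_def flip: scaleR_conv_of_real)
     (simp add: imag_part_def)

lemma imag_part_phi: "J \<in> \<S> \<Longrightarrow> imag_part (phi J z) = Im z *\<^sub>R J"
  by (simp add: imag_part_def phi_def imag_units_iff scaleR_conv_of_real)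

lemma unit_part_phi: "J \<in> \<S> \<Longrightarrow> Im z > 0 \<Longrightarrow> unit_part (phi J z) = J"
  by (simp add: unit_part_def imag_part_phi) (simp add: imag_units_iff)

lemma upper_coord_phi: "J \<in> \<S> \<Longrightarrow> Im z \<ge> 0 \<Longrightarrow> upper_coord (phi J z) = z"
  by (simp add: upper_coord_def imag_part_phi) (simp add: imag_units_iff phi_def complex_eq_iff)

text \<open>A real \<open>x\<close> determines no unit, so the given \<open>J\<close> is taken
  there; any other \<open>x\<close> supplies its own unit.\<close>

lemma quat_eq_phi:
  assumes "J \<in> \<S>"
  obtains K z where "K \<in> \<S>" "Im z \<ge> 0" "x = phi K z"
proof (cases "imag_part x = 0")
  case True
  then have "x = phi J (of_real (q0 x))"
    by (simp add: imag_part_def phi_of_real)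
  then show ?thesis
    using that[of J "of_real (q0 x)"] assms by simp
next
  case False
  show ?thesis
    using that[of "unit_part x" "upper_coord x"] False
    by (simp add: unit_part_in_imag_units phi_unit_part) (simp add: upper_coord_def)
qed

section \<open>The representation formula\<close>

text \<open>Composing \<open>h\<close> with the functionals \<open>x \<mapsto> \<langle>a, x\<rangle> - \<i>\<langle>a, L x\<rangle>\<close>, which turn left
  multiplication by \<open>L\<close> into multiplication by \<open>\<i>\<close>, yields holomorphic functions.\<close>

lemma slice_identity_principle:
  fixes h :: "complex \<Rightarrow> quat"
  assumes L: "L \<in> \<S>" and V: "open V"
    and C: "connected C" "C \<subseteq> V" "of_real r \<in> C" "z \<in> C"
    and h: "\<And>w. w \<in> V \<Longrightarrow> (h has_derivative D w) (at w)"
    and D: "\<And>w. w \<in> V \<Longrightarrow> D w 1 + L * D w \<i> = 0"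
    and real0: "\<And>x. of_real x \<in> V \<Longrightarrow> h (of_real x) = 0"
  shows "h z = 0"
proof -
  \<comment> \<open>The identity theorem is applied on an open connected set, which \<open>C\<close>
    need not be.\<close>
  define W where "W = connected_component_set V (of_real r)"
  have W: "open W" "connected W" "W \<subseteq> V" "C \<subseteq> W"
    using V C by (auto simp: W_def connected_component_subset connected_component_maximal
        intro: open_connected_component)
  \<comment> \<open>This choice makes the real part of \<open>p (h z)\<close> equal to the squared
    norm of \<open>h z\<close>.\<close>
  define a where "a = h z"
  define p where "p x = complex_of_real (a \<bullet> x) - \<i> * complex_of_real (a \<bullet> (L * x))" for x
  have "linear p"
    by (rule linearI) (simp_all add: p_def inner_add_right complex_eq_iff algebra_simps)
  then have p_lin: "bounded_linear p"
    by (simp add: linear_linear)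
  have p_L: "p (L * x) = \<i> * p x" for x
    by (simp add: p_def imag_units_left_mult[OF L] algebra_simps)
  have "((\<lambda>w. p (h w)) has_field_derivative p (D w 1)) (at w)" if "w \<in> W" for w
  proof -
    have w: "w \<in> V"
      using that W by blast
    have lin: "linear (D w)"
      using h[OF w] has_derivative_linear by blast
    have "L * (D w 1 + L * D w \<i>) = 0"
      using D[OF w] by simp
    then have Di: "D w \<i> = L * D w 1"
      by (simp add: distrib_left imag_units_left_mult[OF L])
    \<comment> \<open>The Cauchy-Riemann equation turns the direction \<open>\<i>\<close> into left
      multiplication by \<open>L\<close>, and \<open>p\<close> turns that into multiplication by
      \<open>\<i>\<close>: the composite differential is complex linear.\<close>
    have "(\<lambda>t. p (D w t)) = (*) (p (D w 1))"
    proof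
      fix t
      have "t = Re t *\<^sub>R 1 + Im t *\<^sub>R \<i>"
        by (simp add: complex_eq_iff)
      then have "D w t = Re t *\<^sub>R D w 1 + Im t *\<^sub>R D w \<i>"
        using lin by (metis linear_add linear_scale)
      then have "p (D w t) = Re t *\<^sub>R p (D w 1) + Im t *\<^sub>R (\<i> * p (D w 1))"
        using \<open>linear p\<close> by (simp add: Di linear_add linear_scale p_L)
      then show "p (D w t) = p (D w 1) * t"
        by (simp add: complex_eq_iff algebra_simps)
    qed
    moreover have "((\<lambda>w. p (h w)) has_derivative (\<lambda>t. p (D w t))) (at w)"
      by (rule bounded_linear.has_derivative[OF p_lin h[OF w]])
    ultimately show ?thesis
      unfolding has_field_derivative_def by simp
  qed
  then have hol: "(\<lambda>w. p (h w)) holomorphic_on W"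
    using W(1) by (auto simp: holomorphic_on_open)
  have r: "of_real r \<in> W" and z: "z \<in> W"
    using C W by auto
  \<comment> \<open>The real points of \<open>W\<close> are zeros that accumulate inside
    \<open>W\<close>.\<close>
  have "of_real r islimpt (W \<inter> \<real>)"
  proof -
    have "(of_real r :: complex) islimpt \<real>"
      unfolding islimpt_approachable
    proof (intro allI impI)
      fix e :: real assume "e > 0"
      then show "\<exists>x\<in>\<real>. x \<noteq> (of_real r :: complex) \<and> dist x (of_real r) < e"
        by (intro bexI[of _ "of_real (r + e/2)"]) (auto simp: dist_norm)
    qed
    then show ?thesis
      using r W(1) by (metis islimpt_Int_eventually inf_commute eventually_at_topological)
  qed
  moreover have "p (h w) = 0" if "w \<in> W \<inter> \<real>" for w
    using that W(3) real0 \<open>linear p\<close> by (auto elim!: Reals_cases simp: linear_0)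
  ultimately have "p (h z) = 0"
    using analytic_continuation[OF hol W(1,2) inf_le1 r _ _ z] by blast
  then have "Re (p (h z)) = 0"
    by simp
  then show ?thesis
    by (simp add: p_def a_def)
qed

text \<open>In the slice of \<open>J\<close> itself the formula is pure algebra: the coefficient of
  \<open>f (phi K z)\<close> cancels and that of \<open>f (phi J z)\<close> is 1.\<close>

lemma representation_formula_same:
  assumes "J \<in> \<S>" "K \<in> \<S>" "J \<noteq> K"
  shows "fst (F_pair_upper f J K z) + J * snd (F_pair_upper f J K z) = f (phi J z)"
proof -
  define m where "m = inverse (J - K)"
  have m: "m * (J - K) = 1" "(J - K) * m = 1"
    using assms by (simp_all add: m_def)
  \<comment> \<open>Moving across \<open>J - K\<close> exchanges \<open>J\<close> and
    \<open>K\<close> up to sign, because both squares are -1. Multiplying by \<open>m\<close> on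
    both sides transfers this to the inverse.\<close>
  have "J * (J - K) = - ((J - K) * K)" "K * (J - K) = - ((J - K) * J)"
    using assms by (simp_all add: algebra_simps imag_units_square)
  then have "m * (J * (J - K)) * m = - (m * ((J - K) * K) * m)"
    "m * (K * (J - K)) * m = - (m * ((J - K) * J) * m)"
    by simp_all
  then have mJ: "m * J = - (K * m)" and mK: "m * K = - (J * m)"
    using m by (simp_all add: mult.assoc) (simp_all flip: mult.assoc)
  have "fst (F_pair_upper f J K z) + J * snd (F_pair_upper f J K z) =
      (m * J + J * m) * f (phi J z) - (m * K + J * m) * f (phi K z)"
    by (simp add: F_pair_upper_def m_def algebra_simps)
  also have "\<dots> = ((J - K) * m) * f (phi J z)"
    by (simp add: mJ mK algebra_simps)
  finally show ?thesis
    by (simp add: m)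
qed

text \<open>The difference \<open>h\<close> of both sides satisfies the hypotheses of
  \<open>slice_identity_principle\<close> on the set \<open>V\<close> where all three slices lie in
  \<open>\<Omega>\<close>; the single set \<open>C\<close> joins \<open>z\<close> to the axis within
  \<open>V\<close>.\<close>

lemma representation_formula:
  assumes "open \<Omega>" "slice_regular_on \<Omega> f"
    and S: "J \<in> \<S>" "K \<in> \<S>" "L \<in> \<S>" and "J \<noteq> K"
    and C: "connected C" "of_real r \<in> C" "z \<in> C"
    and sub: "phi J ` C \<subseteq> \<Omega>" "phi K ` C \<subseteq> \<Omega>" "phi L ` C \<subseteq> \<Omega>"
  shows "f (phi L z) = fst (F_pair_upper f J K z) + L * snd (F_pair_upper f J K z)"
proof -
  define m where "m = inverse (J - K)"
  have m: "m * (J - K) = 1"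
    using assms by (simp add: m_def)
  obtain A :: "quat \<Rightarrow> complex \<Rightarrow> complex \<Rightarrow>\<^sub>L quat" where "\<forall>I\<in>\<S>.
      continuous_on (phi I -` \<Omega>) (A I) \<and>
      (\<forall>z \<in> phi I -` \<Omega>.
        ((\<lambda>z. f (phi I z)) has_derivative blinfun_apply (A I z)) (at z) \<and>
        blinfun_apply (A I z) 1 + I * blinfun_apply (A I z) \<i> = 0)"
    using bchoice[OF assms(2)[unfolded slice_regular_on_def]] by blast
  then have A: "\<And>I w. I \<in> \<S> \<Longrightarrow> phi I w \<in> \<Omega> \<Longrightarrow>
      ((\<lambda>w. f (phi I w)) has_derivative blinfun_apply (A I w)) (at w)"
    "\<And>I w. I \<in> \<S> \<Longrightarrow> phi I w \<in> \<Omega> \<Longrightarrow>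
      blinfun_apply (A I w) 1 = - (I * blinfun_apply (A I w) \<i>)"
    by (auto simp: eq_neg_iff_add_eq_0)
  define V where "V = {w. phi J w \<in> \<Omega> \<and> phi K w \<in> \<Omega> \<and> phi L w \<in> \<Omega>}"
  have op: "open (phi I -` \<Omega>)" for I
    using assms(1) continuous_on_phi by (intro open_vimage)
  have "V = phi J -` \<Omega> \<inter> (phi K -` \<Omega> \<inter> phi L -` \<Omega>)"
    by (auto simp: V_def)
  then have V: "open V"
    by (simp only:) (intro open_Int op)
  define h where "h w = f (phi L w) - (m * (J * f (phi J w) - K * f (phi K w))
      + L * (m * (f (phi J w) - f (phi K w))))" for w
  define D where "D w t = A L w t - (m * (J * A J w t - K * A K w t)
      + L * (m * (A J w t - A K w t)))" for w t
  have "h z = 0"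
  proof (rule slice_identity_principle[OF S(3) V C(1) _ C(2,3), where D = D])
    show "C \<subseteq> V"
      using sub by (auto simp: V_def)
    fix w assume w: "w \<in> V"
    then have w: "phi J w \<in> \<Omega>" "phi K w \<in> \<Omega>" "phi L w \<in> \<Omega>"
      by (auto simp: V_def)
    show "(h has_derivative D w) (at w)"
      unfolding h_def[abs_def] D_def[abs_def]
      by (intro has_derivative_diff has_derivative_add has_derivative_mult_right
          A(1)[OF S(1) w(1)] A(1)[OF S(2) w(2)] A(1)[OF S(3) w(3)])
    \<comment> \<open>The equations in the slices of \<open>J\<close> and \<open>K\<close> are the
      Cauchy-Riemann equations for the two stem components, so the terms cancel in pairs.\<close>
    show "D w 1 + L * D w \<i> = 0"
      unfolding D_def A(2)[OF S(1) w(1)] A(2)[OF S(2) w(2)] A(2)[OF S(3) w(3)]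
      using S by (simp add: algebra_simps imag_units_left_mult)
  next
    fix x :: real assume "of_real x \<in> V"
    \<comment> \<open>On the real axis the three values of \<open>f\<close> agree: the first stem
      component is this common value and the second is 0.\<close>
    have "m * (J * y - K * y) = y" for y
      using m by (metis mult.assoc left_diff_distrib mult_1)
    then show "h (of_real x) = 0"
      by (simp add: h_def phi_of_real)
  qed
  then show ?thesis
    by (simp add: h_def F_pair_upper_def m_def)
qed

section \<open>Compact connected sets reaching the real axis\<close>

text \<open>Spearedness only yields a connected component; a path inside it provides the compactness
  that perturbing the unit requires.\<close>

lemma speared_reaches_real:
  assumes "speared U" "I \<in> \<S>" "phi I z \<in> U" "Im z \<ge> 0"
  obtains C r where "compact C" "connected C" "of_real r \<in> C" "z \<in> C"
    "C \<subseteq> {w. Im w \<ge> 0}" "phi I ` C \<subseteq> U"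
proof -
  define A where "A = {w. Im w \<ge> 0} \<inter> phi I -` U"
  define Q where "Q = connected_component_set (half_slice U I) (phi I z)"
  have slice: "half_slice U I = phi I ` A"
    using assms(2) by (auto simp: A_def half_slice_def half_plane_def)
  have coord: "upper_coord (phi I w) = w" if "w \<in> A" for w
    using that assms(2) by (simp add: A_def upper_coord_phi)
  have zA: "z \<in> A"
    using assms by (simp add: A_def)
  then have mem: "phi I z \<in> half_slice U I"
    by (simp add: slice)
  then have "Q \<in> components (half_slice U I)"
    unfolding Q_def by (rule componentsI)
  then obtain r where r: "of_real r \<in> Q"
    using assms unfolding speared_def by blast
  \<comment> \<open>On the half slice \<open>upper_coord\<close> inverts \<open>phi I\<close>, so it
    carries the component back to the plane.\<close>
  have "continuous_on Q upper_coord"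
    by (simp add: continuous_upper_coord continuous_at_imp_continuous_on)
  then have "connected (upper_coord ` Q)"
    by (rule connected_continuous_image) (simp add: Q_def)
  moreover have "Q \<subseteq> phi I ` A"
    unfolding Q_def slice[symmetric] by (rule connected_component_subset)
  then have "upper_coord ` Q \<subseteq> A"
    using coord by fastforce
  moreover have "z \<in> upper_coord ` Q"
    using mem coord[OF zA] by (metis Q_def connected_component_refl imageI mem_Collect_eq)
  moreover have "of_real r \<in> upper_coord ` Q"
    using r upper_coord_phi[OF assms(2), of "of_real r"] by (metis Im_complex_of_real order_refl phi_of_real imageI)
  ultimately have "connected_component A (of_real r) z"
    by (meson connected_component_def)
  \<comment> \<open>\<open>A\<close> is relatively open in a convex set, so its connected components
    are path components.\<close>
  moreover have "locally path_connected A"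
  proof (rule locally_open_subset)
    show "locally path_connected {w. Im w \<ge> 0}"
      by (rule convex_imp_locally_path_connected) (simp add: convex_halfspace_Im_ge)
    have "open (phi I -` U)"
      using assms(1) continuous_on_phi by (intro open_vimage) (auto simp: speared_def)
    then show "openin (top_of_set {w. Im w \<ge> 0}) A"
      by (auto simp: A_def)
  qed
  ultimately have "path_component A (of_real r) z"
    by (metis path_component_eq_connected_component)
  then obtain g where g: "path g" "path_image g \<subseteq> A" "pathstart g = of_real r" "pathfinish g = z"
    by (auto simp: path_component_def)
  show thesis
  proof
    show "compact (path_image g)" "connected (path_image g)"
      using g(1) by auto
    show "of_real r \<in> path_image g" "z \<in> path_image g"
      using g(3,4) by (metis pathstart_in_path_image, metis pathfinish_in_path_image)
    show "path_image g \<subseteq> {w. Im w \<ge> 0}" "phi I ` path_image g \<subseteq> U"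
      using g(2) by (auto simp: A_def)
  qed
qed

text \<open>A connected set joining one point of a component to the real axis stays in that
  component.\<close>

lemma spearedI:
  assumes "open U"
    and "\<And>I z. I \<in> \<S> \<Longrightarrow> phi I z \<in> U \<Longrightarrow> Im z \<ge> 0 \<Longrightarrow>
      \<exists>C r. connected C \<and> C \<subseteq> half_slice U I \<and> phi I z \<in> C \<and> of_real r \<in> C"
  shows "speared U"
  unfolding speared_def
proof (intro conjI ballI assms)
  fix I Q assume I: "I \<in> \<S>" and Q: "Q \<in> components (half_slice U I)"
  then obtain x where x: "x \<in> half_slice U I" "Q = connected_component_set (half_slice U I) x"
    by (auto simp: components_def)
  then obtain z where "x = phi I z" "phi I z \<in> U" "Im z \<ge> 0"
    by (auto simp: half_slice_def half_plane_def)
  then obtain C r where "connected C" "C \<subseteq> half_slice U I" "x \<in> C" "of_real r \<in> C"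
    using assms(2) I by metis
  then show "\<exists>r::real. of_real r \<in> Q"
    using x connected_component_maximal by blast
qed

text \<open>The connected set joining a point to the axis inside \<open>U\<close> cannot leave the
  component of that point.\<close>

lemma speared_component:
  assumes "speared U"
  shows "speared (connected_component_set U x)"
proof (rule spearedI)
  show "open (connected_component_set U x)"
    using assms by (simp add: open_connected_component speared_def)
  fix I z
  assume I: "I \<in> \<S>" and mem: "phi I z \<in> connected_component_set U x" and z: "Im z \<ge> 0"
  have zU: "phi I z \<in> U"
    using mem connected_component_subset by blast
  obtain C r where C: "connected C" "of_real r \<in> C" "z \<in> C"
    "C \<subseteq> {w. Im w \<ge> 0}" "phi I ` C \<subseteq> U"
    using speared_reaches_real[OF assms I zU z] .
  have conn: "connected (phi I ` C)"
    using C(1) by (intro connected_continuous_image continuous_on_phi)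
  have "phi I ` C \<subseteq> connected_component_set U (phi I z)"
    using conn C by (intro connected_component_maximal) auto
  also have "\<dots> = connected_component_set U x"
    using mem by (metis connected_component_eq)
  finally have "phi I ` C \<subseteq> half_slice (connected_component_set U x) I"
    using C(4) by (auto simp: half_slice_def half_plane_def)
  moreover have "of_real r \<in> phi I ` C"
    using C(2) by (metis imageI phi_of_real)
  ultimately show "\<exists>C r. connected C \<and> C \<subseteq> half_slice (connected_component_set U x) I \<and>
      phi I z \<in> C \<and> of_real r \<in> C"
    using conn C(3) by blast
qed

text \<open>A tube argument: \<open>phi\<close> is jointly continuous in unit and coordinate, and
  the compact set \<open>{L} \<times> C\<close> has a uniform neighbourhood in the open preimage of
  \<open>\<Omega>\<close>.\<close>

lemma phi_tube:
  assumes "open \<Omega>" "compact C" "phi L ` C \<subseteq> \<Omega>"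
  obtains e where "e > 0"
    "\<And>K c w. c \<in> C \<Longrightarrow> dist K L < e \<Longrightarrow> dist w c < e \<Longrightarrow> phi K w \<in> \<Omega>"
proof -
  define W where "W = (\<lambda>p. phi (fst p) (snd p)) -` \<Omega>"
  have "open W"
    unfolding W_def phi_def using assms(1) by (intro open_vimage continuous_intros)
  moreover have "{L} \<times> C \<subseteq> W"
    using assms(3) by (auto simp: W_def)
  ultimately obtain e where e: "e > 0" "(\<Union>p\<in>{L} \<times> C. ball p e) \<subseteq> W"
    using assms(2) by (metis compact_Times compact_sing compact_subset_open_imp_ball_epsilon_subset)
  show thesis
  \<comment> \<open>The product distance is at most the sum of the two distances, hence half the
    radius for each.\<close>
  proof (rule that[of "e / 2"])
    fix K c w assume c: "c \<in> C" and d: "dist K L < e / 2" "dist w c < e / 2"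
    have "dist (L, c) (K, w) \<le> dist L K + dist c w"
      by (simp add: dist_Pair_Pair sqrt_sum_squares_le_sum)
    with d have "(K, w) \<in> ball (L, c) e"
      by (simp add: dist_commute)
    with c e(2) have "(K, w) \<in> W"
      by blast
    then show "phi K w \<in> \<Omega>"
      by (simp add: W_def)
  qed (use e in simp)
qed

section \<open>The functions of the slice regular family\<close>

lemma cnj_in_D_pair_iff: "cnj z \<in> D_pair \<Omega> J K \<longleftrightarrow> z \<in> D_pair \<Omega> J K"
  unfolding D_pair_def by (auto simp: image_iff) (metis complex_cnj_cnj)+

text \<open>Two eventual values agree at a common \<open>K\<close>, since the filter is
  nontrivial.\<close>

lemma F_unit_eqI:
  assumes "J \<in> \<S>"
    and w: "\<forall>\<^sub>F K in at J within \<S>. z \<in> D_pair \<Omega> J K \<and> F_pair f J K z = w"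
  shows "F_unit \<Omega> f J z = w"
  unfolding F_unit_def
proof (rule the_equality)
  show "\<forall>\<^sub>F K in at J within \<S>. z \<in> D_pair \<Omega> J K \<and> F_pair f J K z = w"
    by (rule w)
  fix v assume "\<forall>\<^sub>F K in at J within \<S>. z \<in> D_pair \<Omega> J K \<and> F_pair f J K z = v"
  with w have "\<forall>\<^sub>F K in at J within \<S>. v = w"
    by eventually_elim auto
  then show "v = w"
    using at_within_imag_units_nontrivial[OF assms(1)] by (simp add: eventually_const_iff)
qed

text \<open>Near \<open>J\<close> the set \<open>C\<close> stays in \<open>\<Omega>\<close>. A pair
  \<open>(x, y)\<close> is determined by \<open>x + J * y\<close> and \<open>x + K' * y\<close>
  because \<open>J - K'\<close> is invertible, and the representation formula gives the same two
  values for every \<open>K\<close> near \<open>J\<close>. The conjugate clause serves the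
  well-definedness of the induced function.\<close>

lemma eventually_F_unit:
  assumes \<Omega>: "open \<Omega>" "slice_regular_on \<Omega> f" and J: "J \<in> \<S>"
    and C: "compact C" "connected C" "of_real r \<in> C" "z \<in> C" "C \<subseteq> {w. Im w \<ge> 0}" "phi J ` C \<subseteq> \<Omega>"
  shows "\<forall>\<^sub>F K in at J within \<S>. K \<in> \<S> \<and> K \<noteq> J \<and> phi K ` C \<subseteq> \<Omega> \<and>
      F_pair_upper f J K z = F_unit \<Omega> f J z \<and>
      F_unit \<Omega> f J (cnj z) = hc_cnj (F_unit \<Omega> f J z)"
proof -
  obtain e where e: "e > 0"
    "\<And>K c w. c \<in> C \<Longrightarrow> dist K J < e \<Longrightarrow> dist w c < e \<Longrightarrow> phi K w \<in> \<Omega>"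
    using phi_tube[OF \<Omega>(1) C(1,6)] by metis
  have near: "\<forall>\<^sub>F K in at J within \<S>. K \<in> \<S> \<and> K \<noteq> J \<and> phi K ` C \<subseteq> \<Omega>"
    unfolding eventually_at using e by (intro exI[of _ e]) auto
  \<comment> \<open>One fixed nearby unit supplies the candidate value with which all other
    \<open>K\<close> are compared.\<close>
  then obtain K' where K': "K' \<in> \<S>" "K' \<noteq> J" "phi K' ` C \<subseteq> \<Omega>"
    using eventually_happens'[OF at_within_imag_units_nontrivial[OF J]] by blast
  define w where "w = F_pair_upper f J K' z"
  have z: "Im z \<ge> 0"
    using C by auto
  have pair: "\<forall>\<^sub>F K in at J within \<S>. z \<in> D_pair \<Omega> J K \<and> F_pair f J K z = w"
    using near
  proof eventually_elim
    case (elim K)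
    then have K: "K \<in> \<S>" "J \<noteq> K" "phi K ` C \<subseteq> \<Omega>"
      by auto
    let ?F = "F_pair_upper f J K z"
    have K_eq: "fst ?F + J * snd ?F = f (phi J z)"
      by (rule representation_formula_same[OF J K(1,2)])
    have "fst ?F + K' * snd ?F = f (phi K' z)"
      using representation_formula[OF \<Omega> J K(1) K'(1) K(2) C(2-4) C(6) K(3) K'(3)] by simp
    with K_eq have "(J - K') * snd ?F = f (phi J z) - f (phi K' z)"
      by (simp add: algebra_simps flip: K_eq)
    moreover have "inverse (J - K') * (J - K') = 1"
      using K'(2) by simp
    ultimately have "snd ?F = snd w"
      by (simp add: w_def F_pair_upper_def) (metis mult.assoc mult_1)
    moreover have "fst w + J * snd w = f (phi J z)"
      unfolding w_def using K' by (intro representation_formula_same J) auto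
    ultimately have "?F = w"
      using K_eq by (metis add_right_cancel prod_eqI)
    moreover have "z \<in> E_pair \<Omega> J K"
      using J K C z by (auto simp: E_pair_def phi_in_half_slice_iff)
    ultimately show ?case
      using z by (simp add: D_pair_def F_pair_def)
  qed
  then have F: "F_unit \<Omega> f J z = w"
    by (rule F_unit_eqI[OF J])
  have "\<forall>\<^sub>F K in at J within \<S>. cnj z \<in> D_pair \<Omega> J K \<and> F_pair f J K (cnj z) = hc_cnj w"
    using pair by eventually_elim (simp add: cnj_in_D_pair_iff F_pair_cnj)
  then have "F_unit \<Omega> f J (cnj z) = hc_cnj w"
    by (rule F_unit_eqI[OF J])
  then show ?thesis
    using eventually_conj[OF near pair] z by (auto elim!: eventually_mono simp: F F_pair_def)
qed

text \<open>For \<open>K\<close> near \<open>J\<close> the set \<open>C\<close> lies in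
  \<open>\<Omega>\<close> in all three slices, so the representation formula expresses
  \<open>f (phi L z)\<close> by the stem function. It remains to check that this value does not
  depend on how the point is written.\<close>

lemma family_fun_eq:
  assumes \<Omega>: "open \<Omega>" "slice_regular_on \<Omega> f" and J: "J \<in> \<S>" and L: "L \<in> \<S>"
    and C: "compact C" "connected C" "of_real r \<in> C" "z \<in> C" "C \<subseteq> {w. Im w \<ge> 0}"
      "phi J ` C \<subseteq> \<Omega>" "phi L ` C \<subseteq> \<Omega>"
  shows "family_fun \<Omega> f J (phi L z) = f (phi L z)"
proof -
  obtain K where K: "K \<in> \<S>" "J \<noteq> K" "phi K ` C \<subseteq> \<Omega>"
    and F: "F_pair_upper f J K z = F_unit \<Omega> f J z"
    and F_cnj: "F_unit \<Omega> f J (cnj z) = hc_cnj (F_unit \<Omega> f J z)"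
    using eventually_happens'[OF at_within_imag_units_nontrivial[OF J] eventually_F_unit[OF \<Omega> J C(1-6)]]
    by blast
  define w where "w = F_unit \<Omega> f J z"
  have fw: "f (phi L z) = fst w + L * snd w"
    using representation_formula[OF \<Omega> J K(1) L K(2) C(2-4) C(6) K(3) C(7)]
    by (simp add: F w_def)
  have z: "z \<in> D_unit \<Omega> J"
    using J C by (auto simp: D_unit_def phi_in_half_slice_iff)
  \<comment> \<open>A real point may be written with any unit, so the second component must vanish
    there.\<close>
  have real_snd: "snd w = 0" if "Im z = 0"
    using that unfolding w_def F[symmetric] by (simp add: F_pair_upper_def phi_real)
  show ?thesis
    unfolding family_fun_def induced_slice_fun_def
  proof (rule the_equality)
    show "\<exists>z'\<in>D_unit \<Omega> J. \<exists>I\<in>\<S>. phi L z = phi I z' \<and>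
        f (phi L z) = fst (F_unit \<Omega> f J z') + I * snd (F_unit \<Omega> f J z')"
      using z L fw by (auto simp: w_def)
  next
    fix y assume "\<exists>z'\<in>D_unit \<Omega> J. \<exists>I\<in>\<S>. phi L z = phi I z' \<and>
        y = fst (F_unit \<Omega> f J z') + I * snd (F_unit \<Omega> f J z')"
    then obtain z' I where I: "I \<in> \<S>" "phi L z = phi I z'"
      and y: "y = fst (F_unit \<Omega> f J z') + I * snd (F_unit \<Omega> f J z')"
      by auto
    \<comment> \<open>Replacing \<open>L\<close> and \<open>z\<close> by \<open>- L\<close> and
      \<open>cnj z\<close> changes two signs, which cancel.\<close>
    show "y = f (phi L z)"
      unfolding fw y using L I
      by (cases rule: phi_eq_phi_cases) (auto simp: F_cnj hc_cnj_def real_snd simp flip: w_def)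
  qed
qed

theorem theorem4p11:
  fixes \<Omega> :: "quat set" and f :: "quat \<Rightarrow> quat" and J\<^sub>0 :: quat
  assumes "speared_domain \<Omega>"
    and "slice_regular_on \<Omega> f"
    and "J\<^sub>0 \<in> \<S>"
  shows "\<exists>\<Lambda>. speared \<Lambda> \<and>
    core \<Omega> \<union> half_slice \<Omega> J\<^sub>0 \<subseteq> \<Lambda> \<and> \<Lambda> \<subseteq> \<Omega> \<inter> family_dom \<Omega> J\<^sub>0 \<and>
    (\<forall>x\<in>\<Lambda>. f x = family_fun \<Omega> f J\<^sub>0 x) \<and>
    (\<forall>x\<^sub>0 \<in> half_slice \<Omega> J\<^sub>0.
      x\<^sub>0 \<in> connected_component_set \<Lambda> x\<^sub>0 \<and>
      speared_domain (connected_component_set \<Lambda> x\<^sub>0) \<and>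
      (\<forall>x \<in> connected_component_set \<Lambda> x\<^sub>0. f x = family_fun \<Omega> f J\<^sub>0 x))"
proof -
  note J = assms(3)
  have \<Omega>: "open \<Omega>" "speared \<Omega>"
    using assms(1) by (auto simp: speared_domain_def speared_def)
  \<comment> \<open>One \<open>C\<close> serves both units, as \<open>family_fun_eq\<close>
    requires. Compactness is for \<open>phi_tube\<close>; the half-plane condition puts the images
    into half slices.\<close>
  define links where "links L C \<longleftrightarrow> compact C \<and> connected C \<and> (\<exists>r. of_real r \<in> C) \<and>
      C \<subseteq> {w. Im w \<ge> 0} \<and> phi J\<^sub>0 ` C \<subseteq> \<Omega> \<and> phi L ` C \<subseteq> \<Omega>" for L C
  define \<Lambda> where "\<Lambda> = {phi L z | L z C. L \<in> \<S> \<and> z \<in> C \<and> links L C}"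

  \<comment> \<open>Stability of links under perturbation of the point\<close>
  have "open \<Lambda>"
  proof (subst open_subopen, intro ballI)
    fix x assume "x \<in> \<Lambda>"
    then obtain L z C r where x: "x = phi L z" and L: "L \<in> \<S>" and zC: "z \<in> C"
      and C: "compact C" "connected C" "of_real r \<in> C" "C \<subseteq> {w. Im w \<ge> 0}"
        "phi J\<^sub>0 ` C \<subseteq> \<Omega>" "phi L ` C \<subseteq> \<Omega>"
      by (auto simp: \<Lambda>_def links_def)
    show "\<exists>T. open T \<and> x \<in> T \<and> T \<subseteq> \<Lambda>"
    \<comment> \<open>Near a real point the unit is not controlled by continuity, so that case uses
      a ball in \<open>\<Omega>\<close> and the isometries \<open>phi I\<close> instead.\<close>
    proof (cases "Im z = 0")
      case True
      define a where "a = Re z"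
      have a: "z = of_real a"
        using True by (simp add: a_def complex_eq_iff)
      have xa: "x = phi I (of_real a)" for I
        by (simp add: x a phi_of_real)
      have "x \<in> \<Omega>"
        using zC C(6) x by auto
      then obtain e where e: "e > 0" "ball x e \<subseteq> \<Omega>"
        using \<Omega>(1) open_contains_ball by blast
      have "y \<in> \<Lambda>" if "y \<in> ball x e" for y
      proof -
        obtain K u where K: "K \<in> \<S>" "Im u \<ge> 0" "y = phi K u"
          using quat_eq_phi[OF J] .
        \<comment> \<open>Every \<open>phi I\<close> maps this segment into the ball around
          \<open>x\<close>, so it is a link for \<open>J\<^sub>0\<close> and \<open>K\<close>
          alike.\<close>
        let ?C = "closed_segment (of_real a) u"
        have "dist (of_real a) u < e"
          using that K(3) dist_phi[OF K(1), of "of_real a" u] by (simp add: xa[of K])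
        then have "?C \<subseteq> ball (of_real a) e"
          using e by (intro closed_segment_subset) auto
        then have "phi I ` ?C \<subseteq> \<Omega>" if "I \<in> \<S>" for I
          using e(2) dist_phi[OF that, of "of_real a"] by (fastforce simp: xa[of I])
        moreover have "?C \<subseteq> {w. Im w \<ge> 0}"
          using K by (intro closed_segment_subset convex_halfspace_Im_ge) auto
        ultimately have "links K ?C"
          unfolding links_def using J K(1) by (auto intro!: exI[of _ a])
        then show "y \<in> \<Lambda>"
          using K by (auto simp: \<Lambda>_def)
      qed
      then show ?thesis
        using e by (intro exI[of _ "ball x e"]) auto
    next
      case False
      then have z: "Im z > 0"
        using zC C(4) by force
      obtain e where e: "e > 0"
        "\<And>K c w. c \<in> C \<Longrightarrow> dist K L < e \<Longrightarrow> dist w c < e \<Longrightarrow> phi K w \<in> \<Omega>"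
        using phi_tube[OF \<Omega>(1) C(1,6)] by metis
      \<comment> \<open>In the slice of \<open>J\<^sub>0\<close> the unit is fixed, but the segment
        added to \<open>C\<close> below must remain in \<open>\<Omega>\<close> there too.\<close>
      obtain d where d: "d > 0"
        "\<And>K c w. c \<in> C \<Longrightarrow> dist K J\<^sub>0 < d \<Longrightarrow> dist w c < d \<Longrightarrow> phi K w \<in> \<Omega>"
        using phi_tube[OF \<Omega>(1) C(1,5)] by metis
      have x0: "imag_part x \<noteq> 0"
        using L z by (auto simp: x imag_part_phi imag_units_iff)
      have "isCont unit_part x"
        unfolding unit_part_def[abs_def] using x0
        by (intro continuous_intros continuous_imag_part) auto
      then have "(unit_part \<longlongrightarrow> L) (nhds x)"
        unfolding continuous_within tendsto_nhds_iff by (simp add: x unit_part_phi[OF L z])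
      then have evL: "\<forall>\<^sub>F y in nhds x. dist (unit_part y) L < e"
        using e(1) by (rule tendstoD)
      have "(upper_coord \<longlongrightarrow> z) (nhds x)"
        using z continuous_upper_coord[of x] unfolding continuous_within tendsto_nhds_iff by (simp add: x upper_coord_phi[OF L])
      then have evz: "\<forall>\<^sub>F y in nhds x. dist (upper_coord y) z < min e d"
        using e(1) d(1) by (intro tendstoD) auto
      have "(imag_part \<longlongrightarrow> imag_part x) (nhds x)"
        using continuous_imag_part[of x] unfolding continuous_within tendsto_nhds_iff by simp
      then have "\<forall>\<^sub>F y in nhds x. imag_part y \<noteq> 0"
        using x0 by (rule tendsto_imp_eventually_ne)
      then have "\<forall>\<^sub>F y in nhds x. y \<in> \<Lambda>"
        using evL evz
      proof eventually_elim
        case (elim y)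
        let ?K = "unit_part y" and ?u = "upper_coord y"
        \<comment> \<open>The old link is extended to the new coordinate; all points of the short
          segment are close to \<open>z\<close>, which belongs to \<open>C\<close>.\<close>
        let ?C = "C \<union> closed_segment z ?u"
        have near: "dist w z < min e d" if "w \<in> closed_segment z ?u" for w
          using elim(3) that dist_in_closed_segment[OF that]
          by (metis dist_commute le_less_trans)
        have "phi ?K w \<in> \<Omega>" "phi J\<^sub>0 w \<in> \<Omega>" if "w \<in> ?C" for w
          using that near[of w] elim(2) e(1) d(1) e(2)[of w ?K w] e(2)[of z ?K w]
            d(2)[of w J\<^sub>0 w] d(2)[of z J\<^sub>0 w] zC by auto
        moreover have "connected ?C"
          using C(2) zC by (intro connected_Un) auto
        moreover have "closed_segment z ?u \<subseteq> {w. Im w \<ge> 0}"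
          using z by (intro closed_segment_subset convex_halfspace_Im_ge) (auto simp: upper_coord_def)
        ultimately have "links ?K ?C"
          unfolding links_def using C by auto
        moreover have "y = phi ?K ?u" "?K \<in> \<S>"
          using elim(1) by (simp_all add: phi_unit_part unit_part_in_imag_units)
        ultimately show "y \<in> \<Lambda>"
          unfolding \<Lambda>_def by blast
      qed
      then show ?thesis
        by (auto simp: eventually_nhds)
    qed
  qed

  have phi_links: "phi L ` C \<subseteq> \<Lambda>" if "L \<in> \<S>" "links L C" for L C
    using that by (auto simp: \<Lambda>_def)

  \<comment> \<open>Links as connections to the real axis in half slices\<close>
  have speared: "speared \<Lambda>"
  proof (rule spearedI[OF \<open>open \<Lambda>\<close>])
    fix I z assume I: "I \<in> \<S>" and mem: "phi I z \<in> \<Lambda>" and z: "Im z \<ge> 0"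
    from mem obtain L u C where eq: "phi I z = phi L u" and L: "L \<in> \<S>" and u: "u \<in> C" and C: "links L C"
      by (auto simp: \<Lambda>_def)
    then have "Im u \<ge> 0"
      by (auto simp: links_def)
    have real_pt: "of_real r \<in> phi M ` D" if "of_real r \<in> D" for r M D
      using that by (metis imageI phi_of_real)
    have on_axis: "\<exists>C r. connected C \<and> C \<subseteq> half_slice \<Lambda> I \<and> phi I z \<in> C \<and> of_real r \<in> C"
      if "Im z = 0"
    proof -
      have "phi I z \<in> half_slice \<Lambda> I"
        using mem z I by (simp add: phi_in_half_slice_iff)
      then show ?thesis
        using phi_real[OF that, of I]
        by (intro exI[of _ "{phi I z}"] exI[of _ "Re z"]) auto
    qed
    from I L eq show "\<exists>C r. connected C \<and> C \<subseteq> half_slice \<Lambda> I \<and> phi I z \<in> C \<and> of_real r \<in> C"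
    proof (cases rule: phi_eq_phi_cases)
      case 1
      then show ?thesis
        using on_axis by simp
    next
      case 2
      then have "phi I ` C \<subseteq> \<Lambda>"
        using C I phi_links by blast
      moreover have "C \<subseteq> {w. Im w \<ge> 0}"
        using C by (simp add: links_def)
      ultimately have "phi I ` C \<subseteq> half_slice \<Lambda> I"
        using I by (auto simp: phi_in_half_slice_iff image_subset_iff)
      moreover have "connected (phi I ` C)"
        using C by (intro connected_continuous_image continuous_on_phi) (simp add: links_def)
      moreover have "\<exists>r. of_real r \<in> phi I ` C"
        using C real_pt unfolding links_def by blast
      ultimately show ?thesis
        using 2 u by blast
    next
      case 3
      \<comment> \<open>Two conjugate coordinates in the closed upper half-plane are real.\<close>
      with z \<open>Im u \<ge> 0\<close> have "Im z = 0"
        by simp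
      then show ?thesis
        by (rule on_axis)
    qed
  qed

  \<comment> \<open>Inclusion of the half slice and of the core\<close>
  have "half_slice \<Omega> J\<^sub>0 \<subseteq> \<Lambda>"
  proof
    fix x assume "x \<in> half_slice \<Omega> J\<^sub>0"
    then obtain z where z: "x = phi J\<^sub>0 z" "phi J\<^sub>0 z \<in> \<Omega>" "Im z \<ge> 0"
      by (auto simp: half_slice_def half_plane_def)
    obtain C r where "compact C" "connected C" "of_real r \<in> C" "z \<in> C"
      "C \<subseteq> {w. Im w \<ge> 0}" "phi J\<^sub>0 ` C \<subseteq> \<Omega>"
      using speared_reaches_real[OF \<Omega>(2) J z(2,3)] .
    \<comment> \<open>With \<open>L = J\<^sub>0\<close> the two inclusions required of a link
      coincide.\<close>
    then show "x \<in> \<Lambda>"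
      using J z(1) unfolding \<Lambda>_def links_def by blast
  qed
  moreover have "core \<Omega> \<subseteq> \<Lambda>"
  proof
    fix x assume x: "x \<in> core \<Omega>"
    have core: "core \<Omega> \<subseteq> \<Omega>" "symmetric_set (core \<Omega>)" "speared (core \<Omega>)"
      using core_props(1) by auto
    obtain L z where L: "L \<in> \<S>" "Im z \<ge> 0" "x = phi L z"
      using quat_eq_phi[OF J] .
    \<comment> \<open>The link is chosen inside the core, so that symmetry carries it from the slice
      of \<open>L\<close> to that of \<open>J\<^sub>0\<close>.\<close>
    obtain C r where C: "compact C" "connected C" "of_real r \<in> C" "z \<in> C"
      "C \<subseteq> {w. Im w \<ge> 0}" "phi L ` C \<subseteq> core \<Omega>"
      using speared_reaches_real[OF core(3) L(1) _ L(2)] x L(3) by metis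
    have "phi J\<^sub>0 ` C \<subseteq> core \<Omega>"
      using C(6) core(2) J L(1) unfolding symmetric_set_def by blast
    then have "links L C"
      unfolding links_def using C core(1) by blast
    then show "x \<in> \<Lambda>"
      using L C(4) by (auto simp: \<Lambda>_def)
  qed

  \<comment> \<open>Agreement with the slice regular family, and connected components\<close>
  moreover have "x \<in> \<Omega> \<inter> family_dom \<Omega> J\<^sub>0 \<and> f x = family_fun \<Omega> f J\<^sub>0 x" if mem: "x \<in> \<Lambda>" for x
  proof -
    obtain L z C r where x: "x = phi L z" and L: "L \<in> \<S>"
      and C: "compact C" "connected C" "of_real r \<in> C" "z \<in> C" "C \<subseteq> {w. Im w \<ge> 0}"
        "phi J\<^sub>0 ` C \<subseteq> \<Omega>" "phi L ` C \<subseteq> \<Omega>"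
      using mem by (auto simp: \<Lambda>_def links_def)
    have "z \<in> D_unit \<Omega> J\<^sub>0"
      using C J by (auto simp: D_unit_def phi_in_half_slice_iff)
    then have "x \<in> family_dom \<Omega> J\<^sub>0"
      using L x by (auto simp: family_dom_def circularization_def)
    moreover have "x \<in> \<Omega>"
      using C x by auto
    ultimately show ?thesis
      using family_fun_eq[OF \<Omega>(1) assms(2) J L C] x by simp
  qed
  moreover have "speared_domain (connected_component_set \<Lambda> x)" if "x \<in> \<Lambda>" for x
    using that speared_component[OF speared, of x] \<open>open \<Lambda>\<close>
    by (auto simp: speared_domain_def is_domain_def open_connected_component
        intro: exI[of _ x])
  ultimately show ?thesis
    using speared connected_component_subset[of \<Lambda>]
    by (intro exI[of _ \<Lambda>]) (auto simp: subset_iff)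
qed

end
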